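(* Let $k\ge1$ be an integer. For every $N$ there is a $k$-special sequence of length at least $N$ whose entries come from a set of $3k+1$ symbols.
   Context: For a (finite or infinite) sequence $S=s_1,s_2,\dots$ and integer $k\ge1$, a sequence of indices $i_1,\dots,i_{2r}$ ($r\ge1$) is $k$-bad for $S$ if there is $m$ with $1<m\le 2r$ such that: (a) $s_{i_j}=s_{i_{j+r}}$ for $1\le j\le r$; (b) $i_1>i_2>\dots>i_m<i_{m+1}<\dots<i_{2r}$; (c) $|i_j-i_{j+1}|\le k$ for $1\le j<2r$; (d) $i_{m+1}<i_m+k$ if $m<2r$. $S$ is $k$-special if it has no $k$-bad sequence of indices. *)

theory Defs
  imports Complex_Main
begin

text \<open>
  A sequence is a function \<open>s\<close> together with its set \<open>I\<close> of positions: \<open>{1..n}\<close> for a finite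
  sequence of length \<open>n\<close>, and \<open>{1..}\<close> for an infinite one. Values of \<open>s\<close> outside \<open>I\<close> are irrelevant.
  Likewise the index sequence \<open>i\<close> is only inspected at \<open>1, \<dots>, 2 * r\<close>.
\<close>

definition bad_indices ::
  "nat \<Rightarrow> nat set \<Rightarrow> (nat \<Rightarrow> 'a) \<Rightarrow> nat \<Rightarrow> (nat \<Rightarrow> nat) \<Rightarrow> bool" where
  "bad_indices k I s r i \<longleftrightarrow>
     r \<ge> 1 \<and> (\<forall>j\<in>{1..2 * r}. i j \<in> I) \<and>
     (\<exists>m. 1 < m \<and> m \<le> 2 * r \<and>
        (\<forall>j. 1 \<le> j \<and> j \<le> r \<longrightarrow> s (i j) = s (i (j + r))) \<and>
        (\<forall>j. 1 \<le> j \<and> j < m \<longrightarrow> i j > i (j + 1)) \<and>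
        (\<forall>j. m \<le> j \<and> j < 2 * r \<longrightarrow> i j < i (j + 1)) \<and>
        (\<forall>j. 1 \<le> j \<and> j < 2 * r \<longrightarrow> \<bar>int (i j) - int (i (j + 1))\<bar> \<le> int k) \<and>
        (m < 2 * r \<longrightarrow> i (m + 1) < i m + k))"

definition special :: "nat \<Rightarrow> nat set \<Rightarrow> (nat \<Rightarrow> 'a) \<Rightarrow> bool" where
  "special k I s \<longleftrightarrow> \<not> (\<exists>r i. bad_indices k I s r i)"

end

theory Submission imports Defs
begin

text \<open>
  Let \<open>t\<close> be the square-free ternary word of differences of the Thue-Morse word, and insert a fourth
  letter \<open>d\<close> after every second letter of \<open>t\<close>. The resulting word \<open>u\<close> has neither squares nor factors
  \<open>xyx\<close>. Blow up every letter \<open>x \<noteq> d\<close> of \<open>u\<close> to a block \<open>x\<^sub>0 \<dots> x\<^bsub>k-1\<^esub>\<close>, leaving \<open>d\<close> alone; this uses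
  \<open>3k + 1\<close> symbols.

  In a bad index sequence compare the step from \<open>i\<^sub>j\<close> with the one from \<open>i\<^bsub>j+r\<^esub>\<close>. If both have the same
  direction, the equal offsets force them to advance by the same number of letters of \<open>t\<close>. If they have
  opposite directions, a step that stays in its block is matched with one that leaves it, so that both
  must move to the adjacent letter of \<open>u\<close>. Hence a bad sequence produces a square of \<open>t\<close>, a palindrome of
  \<open>u\<close>, or one of a few mixed patterns; the latter are excluded because the \<open>d\<close>'s are aligned with
  the parity of \<open>t\<close>, in which \<open>0\<close> occurs only at odd positions.
\<close>

subsection \<open>The ternary Thue word\<close>

text \<open>The Thue-Morse word: the parity of the binary digit sum.\<close>

fun tm :: "nat \<Rightarrow> bool" where
  "tm n = (if n = 0 then False else (tm (n div 2) \<noteq> odd n))"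

declare tm.simps [simp del]

lemma tm_double [simp]: "tm (2 * n) = tm n"
proof (cases "n = 0")
  case False
  then show ?thesis by (subst tm.simps) simp
qed simp

lemma tm_Suc_double [simp]: "tm (Suc (2 * n)) = (\<not> tm n)"
  by (subst tm.simps) simp

lemma tm_even_neq: "even n \<Longrightarrow> tm (Suc n) \<noteq> tm n"
  by (auto elim!: evenE)

text \<open>One of \<open>n\<close> and \<open>n + 1\<close> is even, and the letter changes after
  an even position.\<close>

lemma tm_no_cube: "\<not> (tm n = tm (n + 1) \<and> tm (n + 1) = tm (n + 2))"
  using tm_even_neq[of n] tm_even_neq[of "n + 1"] by (cases "even n") auto

text \<open>Descent on the period: an even \<open>q\<close> is halved by keeping the positions of
  the parity of \<open>x\<close>, \<open>q = 1\<close> is a cube, and a larger odd \<open>q\<close>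
  forces a long alternating stretch.\<close>

lemma tm_overlap_free:
  assumes "q \<ge> 1" "\<And>j. j \<le> q \<Longrightarrow> tm (x + j) = tm (x + j + q)"
  shows False
  using assms
proof (induction q arbitrary: x rule: less_induct)
  case (less q)
  show False
  proof (cases "even q")
    case True
    then obtain p where p: "q = 2 * p" by (rule evenE)
    have "p \<ge> 1" "p < q" using less.prems(1) p by auto
    moreover have "tm (x div 2 + j) = tm (x div 2 + j + p)" if "j \<le> p" for j
    proof -
      have e: "tm (x + 2 * j) = tm (x + 2 * j + q)"
        using less.prems(2)[of "2 * j"] that p by simp
      show ?thesis
      proof (cases "even x")
        case True
        then obtain y where y: "x = 2 * y" by (rule evenE)
        have "x + 2 * j = 2 * (y + j)" "x + 2 * j + q = 2 * (y + j + p)" using y p by auto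
        then show ?thesis using e y by (metis tm_double nonzero_mult_div_cancel_left zero_neq_numeral)
      next
        case False
        then obtain y where y: "x = 2 * y + 1" by (rule oddE)
        have "x + 2 * j = Suc (2 * (y + j))" "x + 2 * j + q = Suc (2 * (y + j + p))" using y p by auto
        moreover have "x div 2 = y" using y by simp
        ultimately show ?thesis using e by (metis tm_Suc_double)
      qed
    qed
    ultimately show False using less.IH by blast
  next
    case False
    show False
    proof (cases "q = 1")
      case True
      then show False
        using less.prems(2)[of 0] less.prems(2)[of 1] tm_no_cube[of x] by simp
    next
      case q1: False
      then have q3: "q \<ge> 3" using False less.prems(1) by presburger
      \<comment> \<open>The letter always changes after an even position; the odd shift
        \<open>q\<close> carries this over to odd positions.\<close>
      have alt: "tm (Suc n) \<noteq> tm n" if "x \<le> n" "n < x + q" for n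
      proof (cases "even n")
        case True
        then show ?thesis by (rule tm_even_neq)
      next
        case odd: False
        have "tm n = tm (n + q)" "tm (Suc n) = tm (Suc n + q)"
          using less.prems(2)[of "n - x"] less.prems(2)[of "Suc n - x"] that by auto
        moreover have "tm (Suc (n + q)) \<noteq> tm (n + q)"
          by (rule tm_even_neq) (use odd False in simp)
        ultimately show ?thesis by simp
      qed
      have alt2: "tm (Suc n) \<noteq> tm n" if "x + q \<le> n" "n < x + 2 * q" for n
      proof -
        have "tm (n - q) = tm n" "tm (Suc n - q) = tm (Suc n)"
          using less.prems(2)[of "n - q - x"] less.prems(2)[of "Suc n - q - x"] that by auto
        moreover have "tm (Suc (n - q)) \<noteq> tm (n - q)" using alt[of "n - q"] that by auto
        ultimately show ?thesis using that by (simp add: Suc_diff_le)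
      qed
      \<comment> \<open>\<open>4 * n + 1\<close> is the only one of \<open>x\<close>,
        \<open>x + 1\<close>, \<open>x + 2\<close>, \<open>x + 3\<close> congruent to 1 modulo 4.
        After such a position the letter repeats, so alternation fails.\<close>
      define n where "n = (x + 2) div 4"
      have "x \<le> 4 * n + 1" "4 * n + 1 < x + 4" unfolding n_def by presburger+
      then have "tm (Suc (4 * n + 1)) \<noteq> tm (4 * n + 1)"
        using alt[of "4 * n + 1"] alt2[of "4 * n + 1"] q3 by force
      moreover have "Suc (4 * n + 1) = 2 * Suc (2 * n)" "4 * n + 1 = Suc (2 * (2 * n))" by auto
      ultimately show False by (metis tm_double tm_Suc_double)
    qed
  qed
qed

text \<open>The difference of consecutive letters of \<open>tm\<close>, with 0, -1, 1 coded as 0, 1,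
  2.\<close>

definition tern :: "nat \<Rightarrow> nat" where
  "tern n = (if tm n = tm (Suc n) then 0 else if tm n then 1 else 2)"

lemma tern_le: "tern n \<le> 2"
  by (simp add: tern_def)

text \<open>Equal differences make \<open>d\<close>, the change of \<open>tm\<close> over
  \<open>q\<close> positions, constant. If it is 0, \<open>tm\<close> has an overlap; if it is 1 or
  -1, two successive equal changes leave the range from 0 to 1.\<close>

lemma tern_square_free:
  assumes "q \<ge> 1" "\<And>z. x \<le> z \<Longrightarrow> z < x + q \<Longrightarrow> tern z = tern (z + q)"
  shows False
proof -
  define d where "d j = (of_bool (tm (x + j + q)) - of_bool (tm (x + j)) :: int)" for j
  have "d (Suc j) = d j" if "j < q" for j
    using assms(2)[of "x + j"] that unfolding d_def tern_def by (auto split: if_splits)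
  then have d: "d j = d 0" if "j \<le> q" for j
    using that by (induction j) auto
  show False
  proof (cases "d 0 = 0")
    case True
    have "tm (x + j) = tm (x + j + q)" if "j \<le> q" for j
      using d[OF that] True unfolding d_def by (auto split: if_splits simp: of_bool_def)
    then show False using tm_overlap_free[OF assms(1)] by blast
  next
    case False
    then show False using d[of q] unfolding d_def by (auto simp: of_bool_def split: if_splits)
  qed
qed

lemma tern_adjacent: "tern z \<noteq> tern (Suc z)"
  using tern_square_free[of 1 z] by (auto simp: le_less_Suc_eq)

section \<open>Parity constraints on the ternary word\<close>

lemma tern_even: "even n \<Longrightarrow> tern n \<noteq> 0"
  using tm_even_neq[of n] by (auto simp: tern_def)

text \<open>A nonzero letter at position \<open>2 * y + 1\<close> means
  \<open>tm y = tm (y + 1)\<close>, so two successive ones give a cube in \<open>tm\<close>.\<close>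

lemma tern_odd:
  assumes "odd n" "tern n \<noteq> 0" "tern (n + 2) \<noteq> 0"
  shows False
proof -
  obtain y where y: "n = 2 * y + 1" using assms(1) by (rule oddE)
  have "tm n = (\<not> tm y)" "tm (Suc n) = tm (y + 1)"
    "tm (n + 2) = (\<not> tm (y + 1))" "tm (Suc (n + 2)) = tm (y + 2)"
    using tm_Suc_double[of y] tm_double[of "y + 1"] tm_Suc_double[of "y + 1"] tm_double[of "y + 2"] y
    by simp_all
  then show False using assms(2,3) tm_no_cube[of y] by (auto simp: tern_def split: if_splits)
qed

text \<open>At even positions \<open>tern\<close> determines \<open>tm y\<close>, so the hypothesis
  says \<open>tm y = tm (y + 1)\<close>. Cube-freeness makes \<open>tm\<close> change on either side
  of this pair, which gives a 0 at the odd positions there.\<close>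

lemma tern_even_return:
  assumes "tern (2 * y) = tern (2 * y + 2)"
  shows "tern (2 * y + 3) = 0" "y \<ge> 1 \<Longrightarrow> tern (2 * y - 1) = 0"
proof -
  have tm: "tm (2 * y) = tm y" "tm (2 * y + 1) = (\<not> tm y)" "tm (2 * y + 2) = tm (y + 1)"
    "tm (2 * y + 3) = (\<not> tm (y + 1))" "tm (2 * y + 4) = tm (y + 2)"
    using tm_double[of y] tm_double[of "y + 1"] tm_double[of "y + 2"]
      tm_Suc_double[of y] tm_Suc_double[of "y + 1"] by (simp_all add: numeral_3_eq_3 eval_nat_numeral)
  have eq: "tm y = tm (y + 1)"
    using assms tm by (auto simp: tern_def eval_nat_numeral split: if_splits)
  then show "tern (2 * y + 3) = 0"
    using tm_no_cube[of y] tm by (auto simp: tern_def eval_nat_numeral)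
  assume "y \<ge> 1"
  then obtain w where w: "y = Suc w" by (cases y) auto
  have "2 * y - 1 = Suc (2 * w)" "Suc (2 * y - 1) = 2 * (w + 1)" using w by auto
  then have "tm (2 * y - 1) = (\<not> tm w)" "tm (Suc (2 * y - 1)) = tm (w + 1)"
    using tm_Suc_double[of w] tm_double[of "w + 1"] by metis+
  then show "tern (2 * y - 1) = 0"
    using eq w tm_no_cube[of w] by (auto simp: tern_def)
qed

subsection \<open>The word over four letters\<close>

text \<open>
  A cell is a position in \<open>u\<close>; the cells congruent to 2 modulo 3 carry the letter \<open>d\<close>, coded by 3.
  The other cells correspond to the positions of \<open>t\<close> by \<open>blk\<close>, with inverse \<open>cell_of\<close>; on a \<open>d\<close>-cell,
  \<open>blk\<close> gives the position of the next letter of \<open>t\<close>.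
\<close>

definition blk :: "nat \<Rightarrow> nat" where "blk g = 2 * (g div 3) + g mod 3"

definition cell_of :: "nat \<Rightarrow> nat" where "cell_of z = 3 * (z div 2) + z mod 2"

definition clr :: "nat \<Rightarrow> nat" where "clr g = (if g mod 3 = 2 then 3 else tern (blk g))"

lemma clr_le: "clr g \<le> 3"
  using tern_le[of "blk g"] by (simp add: clr_def)

lemma clr_eq_3 [simp]: "clr g = 3 \<longleftrightarrow> g mod 3 = 2"
  using tern_le[of "blk g"] by (simp add: clr_def)

lemma mod3_cases:
  fixes g :: nat
  obtains a where "g = 3 * a" | a where "g = 3 * a + 1" | a where "g = 3 * a + 2"
proof -
  have "\<exists>a. g = 3 * a \<or> g = 3 * a + 1 \<or> g = 3 * a + 2" by presburger
  then show thesis using that by blast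
qed

lemma blk_simps [simp]: "blk (3 * a) = 2 * a" "blk (3 * a + 1) = 2 * a + 1" "blk (3 * a + 2) = 2 * a + 2"
  "blk (Suc (3 * a)) = 2 * a + 1" "blk (Suc (Suc (3 * a))) = 2 * a + 2"
  by (simp_all add: blk_def div_Suc mod_Suc)

lemma cell_of_simps [simp]: "cell_of (2 * a) = 3 * a" "cell_of (2 * a + 1) = 3 * a + 1"
  "cell_of (Suc (2 * a)) = 3 * a + 1"
  by (simp_all add: cell_of_def)

lemma clr_simps [simp]: "clr (3 * a) = tern (2 * a)" "clr (3 * a + 1) = tern (2 * a + 1)"
  "clr (3 * a + 2) = 3" "clr (Suc (3 * a)) = tern (2 * a + 1)" "clr (Suc (Suc (3 * a))) = 3"
  by (simp_all add: clr_def mod_Suc)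

lemma blk_cell_of [simp]: "blk (cell_of z) = z"
  by (cases "even z") (auto elim!: evenE oddE)

lemma cell_of_blk: "g mod 3 \<noteq> 2 \<Longrightarrow> cell_of (blk g) = g"
  by (cases g rule: mod3_cases) (auto simp: mod_Suc)

lemma cell_of_mod [simp]: "cell_of z mod 3 = z mod 2"
  by (cases "even z") (auto elim!: evenE oddE simp: mod_Suc)

lemma clr_cell_of [simp]: "clr (cell_of z) = tern z"
  by (cases "even z") (auto elim!: evenE oddE)

lemma strict_mono_cell_of: "strict_mono cell_of"
  unfolding strict_mono_Suc_iff
proof
  fix z show "cell_of z < cell_of (Suc z)"
    using cell_of_simps(1)[of "Suc (z div 2)"] by (cases "even z") (auto elim!: evenE oddE)
qed

lemmas cell_of_less = strict_mono_less[OF strict_mono_cell_of]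
lemmas cell_of_le = strict_mono_less_eq[OF strict_mono_cell_of]

lemma clr_Suc: "clr g \<noteq> clr (g + 1)"
proof (cases g rule: mod3_cases)
  case (1 a)
  then show ?thesis using tern_adjacent[of "2 * a"] by simp
next
  case (2 a)
  then show ?thesis using tern_le[of "2 * a + 1"] by simp
next
  case (3 a)
  then have "g + 1 = 3 * (a + 1)" by simp
  then show ?thesis using 3 tern_le[of "2 * (a + 1)"] clr_simps(1)[of "a + 1"] by fastforce
qed

text \<open>At distance two, either exactly one of the cells is a mark \<open>d\<close>, or a mark
  lies between two adjacent letters of \<open>t\<close>, which differ.\<close>

lemma clr_Suc_Suc: "clr g \<noteq> clr (g + 2)"
proof (cases g rule: mod3_cases)
  case (1 a)
  then show ?thesis using tern_le[of "2 * a"] by simp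
next
  case (2 a)
  then have "g + 2 = 3 * (a + 1)" by simp
  then have "clr (g + 2) = tern (2 * (a + 1))" by (simp only: clr_simps)
  then show ?thesis using 2 tern_adjacent[of "2 * a + 1"] by simp
next
  case (3 a)
  then have "g + 2 = 3 * (a + 1) + 1" by simp
  then show ?thesis using 3 tern_le[of "2 * (a + 1) + 1"] clr_simps(2)[of "a + 1"] by fastforce
qed

lemma clr_near:
  assumes "clr g = clr h" "g \<le> h + 2" "h \<le> g + 2"
  shows "g = h"
proof -
  have "g = h \<or> h = g + 1 \<or> h = g + 2 \<or> g = h + 1 \<or> g = h + 2" using assms by linarith
  then show ?thesis
    using assms(1) clr_Suc[of g] clr_Suc[of h] clr_Suc_Suc[of g] clr_Suc_Suc[of h] by metis
qed

text \<open>\<open>H l - G l\<close> grows by two with \<open>l\<close>, so it takes a value in \<open>{-2, -1, 1, 2}\<close>.\<close>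

lemma clr_mirror:
  fixes G H :: "nat \<Rightarrow> nat"
  assumes "\<And>l. l \<le> h \<Longrightarrow> clr (G l) = clr (H l)"
    and "\<And>l. l \<le> h \<Longrightarrow> G l + l = G 0" "\<And>l. l \<le> h \<Longrightarrow> H l = H 0 + l"
    and "h \<ge> 1" "H 0 \<le> G h + 2" "G h \<le> H 0 + 2"
  shows False
proof -
  define D where "D l = int (H l) - int (G l)" for l
  have D: "D l = D 0 + 2 * int l" if "l \<le> h" for l
    using assms(2,3)[OF that] assms(2)[of 0] unfolding D_def by linarith
  have Gh: "G h + h = G 0" using assms(2) by blast
  have lo: "D 0 \<le> 2 - int h" "D 0 \<ge> - 2 - int h" using Gh assms(5,6) unfolding D_def by linarith+
  obtain l where l: "l \<le> h" "D 0 + 2 * int l \<in> {- 2, - 1, 1, 2}"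
  proof -
    \<comment> \<open>\<open>h >= 1\<close> gives \<open>D 0 <= 1\<close>. From 0 one step leads to
      2; a negative value climbs by twos to -2 or -1, and \<open>D 0 >= -2 - h\<close> keeps this
      within \<open>h\<close> steps.\<close>
    consider "D 0 = 0" | "D 0 = 1" | "D 0 \<le> - 1" "even (D 0)" | "D 0 \<le> - 1" "odd (D 0)"
      using lo assms(4) by linarith
    then show thesis
    proof cases
      case 1
      then show thesis using that[of 1] assms(4) by simp
    next
      case 2
      then show thesis using that[of 0] by simp
    next
      case 3
      then obtain e where "D 0 = 2 * e" by (auto elim: evenE)
      then show thesis using that[of "nat (- e - 1)"] 3 lo by auto
    next
      case 4
      then obtain e where "D 0 = 2 * e + 1" by (auto elim: oddE)
      then show thesis using that[of "nat (- e - 1)"] 4 lo by auto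
    qed
  qed
  then have Dl: "D l \<noteq> 0" "\<bar>D l\<bar> \<le> 2" using D[OF l(1)] by auto
  have "G l = H l" using Dl(2) by (intro clr_near[OF assms(1)[OF l(1)]]) (auto simp: D_def)
  then show False using Dl(1) by (simp add: D_def)
qed

section \<open>Translating cells into positions of the ternary word\<close>

lemma blk_add: "blk (Suc g) = (if g mod 3 = 2 then blk g else blk g + 1)"
  "g mod 3 = 1 \<Longrightarrow> blk (Suc (Suc g)) = blk g + 1"
proof -
  have next_mark: "blk (Suc (Suc (Suc (3 * a)))) = 2 * a + 2" for a
  proof -
    have "Suc (Suc (Suc (3 * a))) = 3 * (a + 1)" by simp
    then show ?thesis by (simp only: blk_simps)
  qed
  show "blk (Suc g) = (if g mod 3 = 2 then blk g else blk g + 1)"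
    by (cases g rule: mod3_cases) (auto simp: mod_Suc next_mark)
  assume "g mod 3 = 1"
  then show "blk (Suc (Suc g)) = blk g + 1"
    by (cases g rule: mod3_cases) (auto simp: mod_Suc next_mark)
qed

text \<open>\<open>blk\<close> is monotone and identifies only a mark with the cell following
  it.\<close>

lemma blk_less:
  assumes "g < h"
  shows "blk g < blk h \<or> h = g + 1"
  using assms by (cases g rule: mod3_cases; cases h rule: mod3_cases) auto

lemma cell_of_blk_mark: "g mod 3 = 2 \<Longrightarrow> cell_of (blk g) = g + 1"
proof (cases g rule: mod3_cases)
  case (3 a)
  have "cell_of (2 * (a + 1)) = 3 * (a + 1)" by (rule cell_of_simps)
  then show ?thesis using 3 by simp
qed (simp_all add: mod_Suc)

lemma even_blk_mark: "g mod 3 = 2 \<Longrightarrow> even (blk g)"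
  by (simp add: blk_def)

text \<open>The form for falling walks, where a letter is matched with an earlier one; naming
  \<open>y\<close> avoids truncated subtraction.\<close>

lemma tern_square_free_left:
  assumes "q \<ge> 1" "\<And>z. x \<le> z \<Longrightarrow> z < x + q \<Longrightarrow> \<exists>y. z = y + q \<and> tern z = tern y"
  shows False
proof -
  have "x \<ge> q" using assms(2)[of x] assms(1) by auto
  moreover have "tern z = tern (z + q)" if "x - q \<le> z" "z < x - q + q" for z
    using assms(2)[of "z + q"] that \<open>x \<ge> q\<close> by auto
  ultimately show False using tern_square_free[OF assms(1), of "x - q"] by blast
qed

subsection \<open>Blowing up letters\<close>

locale blow_up =
  fixes k :: nat
  assumes k_pos: "k \<ge> 1"
begin

definition start :: "nat \<Rightarrow> nat" where "start g = (2 * k + 1) * (g div 3) + k * (g mod 3)"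

definition cell :: "nat \<Rightarrow> nat" where "cell n = (LEAST g. n < start (Suc g))"

definition off :: "nat \<Rightarrow> nat" where "off n = n - start (cell n)"

text \<open>Letter and offset are the two digits in base \<open>k\<close>. A mark has letter 3 and
  only the offset 0, hence the single code \<open>3 * k\<close>.\<close>

definition word :: "nat \<Rightarrow> nat" where "word n = clr (cell n) * k + off n"

section \<open>Locating a position by cell and offset\<close>

lemma start_Suc: "start (Suc g) = start g + (if g mod 3 = 2 then 1 else k)"
proof (cases g rule: mod3_cases)
  case (3 a)
  then have "Suc g = 3 * (a + 1)" by simp
  then have "start (Suc g) = (2 * k + 1) * (a + 1)" unfolding start_def by simp
  then show ?thesis using 3 by (simp add: start_def mod_Suc div_Suc)
qed (simp_all add: start_def mod_Suc div_Suc)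

lemma strict_mono_start: "strict_mono start"
  unfolding strict_mono_Suc_iff using k_pos by (simp add: start_Suc)

lemma start_0 [simp]: "start 0 = 0"
  by (simp add: start_def)

lemma cell_upper: "n < start (Suc (cell n))"
proof -
  have "n < start (Suc n)" using strict_mono_imp_increasing[OF strict_mono_start, of "Suc n"] by simp
  then show ?thesis unfolding cell_def by (rule LeastI)
qed

lemma cell_lower: "start (cell n) \<le> n"
proof (cases "cell n")
  case (Suc g)
  then have "g < cell n" by simp
  then have "\<not> n < start (Suc g)" unfolding cell_def by (rule not_less_Least)
  then show ?thesis using Suc by simp
qed simp

lemma start_off: "start (cell n) + off n = n"
  using cell_lower by (simp add: off_def)

lemma le_cell: "g \<le> cell n \<longleftrightarrow> start g \<le> n"
proof
  assume "g \<le> cell n"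
  then have "start g \<le> start (cell n)" by (simp add: strict_mono_less_eq[OF strict_mono_start])
  then show "start g \<le> n" using cell_lower[of n] by simp
next
  assume "start g \<le> n"
  then have "start g < start (Suc (cell n))" using cell_upper[of n] by simp
  then show "g \<le> cell n" by (simp add: strict_mono_less[OF strict_mono_start])
qed

lemma cell_mono: "m \<le> n \<Longrightarrow> cell m \<le> cell n"
  using le_cell cell_lower order_trans by blast

lemma off_less: "off n < k"
  using cell_upper[of n] k_pos start_Suc[of "cell n"] start_off[of n] by (auto split: if_splits)

lemma off_mark: "cell n mod 3 = 2 \<Longrightarrow> off n = 0"
  using cell_upper[of n] start_Suc[of "cell n"] start_off[of n] by auto

lemma word_eq_iff: "word m = word n \<longleftrightarrow> clr (cell m) = clr (cell n) \<and> off m = off n"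
proof
  assume eq: "word m = word n"
  have "word m div k = clr (cell m)" "word n div k = clr (cell n)"
    using off_less[of m] off_less[of n] by (simp_all add: word_def)
  then show "clr (cell m) = clr (cell n) \<and> off m = off n" using eq by (simp add: word_def)
qed (simp add: word_def)

lemma word_less: "word n < 3 * k + 1"
proof (cases "cell n mod 3 = 2")
  case True
  then show ?thesis using off_mark by (simp add: word_def clr_def)
next
  case False
  then have "clr (cell n) \<le> 2" using clr_eq_3[of "cell n"] clr_le[of "cell n"] by linarith
  then have "clr (cell n) * k \<le> 2 * k" by (rule mult_right_mono) simp
  then show ?thesis using off_less[of n] unfolding word_def by linarith
qed

text \<open>A move of at most \<open>k\<close> cannot pass over a full block of length
  \<open>k\<close>. It can only skip a mark, which has length 1, and only from the block just before
  it.\<close>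

lemma step_cases:
  assumes "a < b" "b \<le> a + k"
  obtains "cell b = cell a" "cell a mod 3 \<noteq> 2" "off b = off a + (b - a)"
  | "cell b = cell a + 1" "cell a mod 3 \<noteq> 2" "off b + k = off a + (b - a)"
  | "cell b = cell a + 1" "cell a mod 3 = 2" "off b + 1 = b - a"
  | "cell b = cell a + 2" "cell a mod 3 = 1" "off b + k + 1 = off a + (b - a)"
proof -
  have ge: "cell a \<le> cell b" using assms(1) by (simp add: cell_mono)
  have s: "start (cell a + 1) = start (cell a) + (if cell a mod 3 = 2 then 1 else k)"
    "start (cell a + 2) = start (cell a + 1) + (if (cell a + 1) mod 3 = 2 then 1 else k)"
    "start (cell a + 3) = start (cell a + 2) + (if (cell a + 2) mod 3 = 2 then 1 else k)"
  proof -
    have "cell a + 1 = Suc (cell a)" "cell a + 2 = Suc (cell a + 1)" "cell a + 3 = Suc (cell a + 2)"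
      by simp_all
    then show "start (cell a + 1) = start (cell a) + (if cell a mod 3 = 2 then 1 else k)"
      "start (cell a + 2) = start (cell a + 1) + (if (cell a + 1) mod 3 = 2 then 1 else k)"
      "start (cell a + 3) = start (cell a + 2) + (if (cell a + 2) mod 3 = 2 then 1 else k)"
      by (simp_all only: start_Suc)
  qed
  have ab: "start (cell a) + off a = a" "start (cell b) + off b = b" by (rule start_off)+
  have up: "a < start (cell a + 1)" using cell_upper[of a] by simp
  show thesis
  proof (cases "cell a" rule: mod3_cases)
    case (1 c)
    then have m: "cell a mod 3 = 0" "(cell a + 1) mod 3 = 1" by (simp_all add: mod_Suc)
    have "b < start (cell a + 2)" using s m up assms(2) by simp
    then have "\<not> cell a + 2 \<le> cell b" using le_cell by simp
    then have "cell b = cell a \<or> cell b = cell a + 1" using ge by linarith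
    then show thesis using that(1,2) m s ab assms(1) by auto
  next
    case (2 c)
    then have m: "cell a mod 3 = 1" "(cell a + 1) mod 3 = 2" "(cell a + 2) mod 3 = 0"
      by (simp_all add: mod_Suc)
    have "b < start (cell a + 3)" using s m up assms(2) by simp
    then have "\<not> cell a + 3 \<le> cell b" using le_cell by simp
    then have "cell b = cell a \<or> cell b = cell a + 1 \<or> cell b = cell a + 2" using ge by linarith
    then show thesis using that(1,2,4) m s ab assms(1) by auto
  next
    case (3 c)
    then have m: "cell a mod 3 = 2" "(cell a + 1) mod 3 = 0" by (simp_all add: mod_Suc)
    have o: "off a = 0" using off_mark m(1) by simp
    then have "b < start (cell a + 2)" using s m ab(1) assms(2) by simp
    then have "\<not> cell a + 2 \<le> cell b" using le_cell by simp
    moreover have "start (cell a + 1) \<le> b" using s m ab(1) o assms(1) by simp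
    then have "cell a + 1 \<le> cell b" using le_cell by simp
    ultimately have "cell b = cell a + 1" by linarith
    then show thesis using that(3) m s ab assms(1) o by auto
  qed
qed

lemma step_cell:
  assumes "\<bar>int a - int b\<bar> \<le> int k"
  shows "cell a \<le> cell b + 2" "cell b \<le> cell a + 2"
proof -
  have "cell a \<le> cell b + 2 \<and> cell b \<le> cell a + 2"
  proof (cases a b rule: linorder_cases)
    case less
    then have "b \<le> a + k" using assms by simp
    with less show ?thesis by (cases rule: step_cases) auto
  next
    case greater
    then have "a \<le> b + k" using assms by simp
    with greater show ?thesis by (cases rule: step_cases) auto
  qed simp
  then show "cell a \<le> cell b + 2" "cell b \<le> cell a + 2" by auto
qed

text \<open>A move within a block raises the offset; one from a block into another cell does not
  raise it, and lowers it if it skips a mark. Opposite moves see the same two offsets in reverse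
  order, so skips are excluded. Between two blocks the offsets agree and the move has length exactly
  \<open>k\<close>, which is later confronted with \<open>turn\<close>.\<close>

lemma opposite_steps:
  assumes "a2 < a1" "a1 \<le> a2 + k" "b1 < b2" "b2 \<le> b1 + k"
    and "word a1 = word b1" "word a2 = word b2"
  shows "cell a1 = cell a2 + 1" "cell b2 = cell b1 + 1"
    and "cell a1 mod 3 \<noteq> 2 \<Longrightarrow> cell a2 mod 3 \<noteq> 2 \<Longrightarrow> b2 = b1 + k"
proof -
  have w: "clr (cell a1) = clr (cell b1)" "off a1 = off b1" "clr (cell a2) = clr (cell b2)" "off a2 = off b2"
    using assms(5,6) by (simp_all add: word_eq_iff)
  have m: "cell a1 mod 3 = 2 \<longleftrightarrow> cell b1 mod 3 = 2" "cell a2 mod 3 = 2 \<longleftrightarrow> cell b2 mod 3 = 2"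
    using w clr_eq_3 by metis+
  have c: "clr (Suc (cell a2)) \<noteq> clr (cell a2)" "clr (Suc (Suc (cell a2))) \<noteq> clr (cell a2)"
    using clr_Suc[of "cell a2"] clr_Suc_Suc[of "cell a2"] by simp_all
  have o: "off a1 < k" "off a2 < k" by (rule off_less)+
  have "cell a1 = cell a2 + 1 \<and> cell b2 = cell b1 + 1 \<and>
    (cell a1 mod 3 \<noteq> 2 \<longrightarrow> cell a2 mod 3 \<noteq> 2 \<longrightarrow> b2 = b1 + k)"
    using assms(1,2)
  proof (cases rule: step_cases)
    case 1
    then have "clr (cell b1) = clr (cell b2)" using w by simp
    then have "cell b2 = cell b1"
      using clr_near[of "cell b1" "cell b2"] step_cell[of b1 b2] assms(3,4) by simp
    with assms(3,4) show ?thesis using 1 w assms(1) by (cases rule: step_cases) auto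
  next
    case 2
    with assms(3,4) show ?thesis using w m assms o c
      by (cases rule: step_cases) (auto simp: off_mark mod_Suc)
  next
    case 3
    with assms(3,4) show ?thesis using w m assms o c
      by (cases rule: step_cases) (auto simp: mod_Suc off_mark)
  next
    case 4
    with assms(3,4) show ?thesis using w m assms o c
      by (cases rule: step_cases) (auto simp: mod_Suc off_mark)
  qed
  then show "cell a1 = cell a2 + 1" "cell b2 = cell b1 + 1"
    "cell a1 mod 3 \<noteq> 2 \<Longrightarrow> cell a2 mod 3 \<noteq> 2 \<Longrightarrow> b2 = b1 + k" by auto
qed

section \<open>Moves measured in letters of the ternary word\<close>

abbreviation "block n \<equiv> blk (cell n)"

text \<open>From a mark, \<open>block\<close> does not change. From a letter, it stays if the offset
  grows and otherwise rises by one, whether or not a mark is skipped. So symbols at both ends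
  determine the advance.\<close>

lemma parallel_steps:
  assumes "a1 < a2" "a2 \<le> a1 + k" "b1 < b2" "b2 \<le> b1 + k"
    and "word a1 = word b1" "word a2 = word b2"
  shows "block a2 + block b1 = block b2 + block a1"
proof -
  have w: "off a1 = off b1" "off a2 = off b2" using assms(5,6) by (simp_all add: word_eq_iff)
  have m: "cell a1 mod 3 = 2 \<longleftrightarrow> cell b1 mod 3 = 2" "cell a2 mod 3 = 2 \<longleftrightarrow> cell b2 mod 3 = 2"
    using assms(5,6) clr_eq_3 word_eq_iff by metis+
  from assms(1,2) show ?thesis
  proof (cases rule: step_cases)
    case 1
    with assms(3,4) show ?thesis using w m assms by (cases rule: step_cases) auto
  next
    case 2
    with assms(3,4) show ?thesis using w m assms
      by (cases rule: step_cases) (auto simp: blk_add mod_Suc)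
  next
    case 3
    with assms(3,4) show ?thesis using w m assms
      by (cases rule: step_cases) (auto simp: blk_add mod_Suc)
  next
    case 4
    with assms(3,4) show ?thesis using w m assms
      by (cases rule: step_cases) (auto simp: blk_add mod_Suc)
  qed
qed

text \<open>Equal offsets exclude a common cell and equal letters exclude adjacent cells, the only
  ways to share a block number.\<close>

lemma block_less:
  assumes "m < n" "word m = word n"
  shows "block m < block n"
proof -
  have w: "clr (cell m) = clr (cell n)" "off m = off n" using assms(2) by (simp_all add: word_eq_iff)
  have "cell m \<noteq> cell n" using w(2) start_off[of m] start_off[of n] assms(1) by auto
  then have "cell m < cell n" using cell_mono[of m n] assms(1) by simp
  then show ?thesis using blk_less[of "cell m" "cell n"] clr_Suc[of "cell m"] w(1) by auto
qed

lemma step_avoid: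
  assumes "\<bar>int a - int b\<bar> \<le> int k" "g mod 3 \<noteq> 2" "cell a < g" "cell b \<noteq> g"
  shows "cell b < g"
proof (rule ccontr)
  assume "\<not> cell b < g"
  then have g: "g < cell b" using assms(4) by simp
  then have "a < b" using assms(3) cell_mono[of b a] by (meson leD less_trans not_less)
  moreover have "b \<le> a + k" using assms(1) by simp
  ultimately show False
    using g assms(2,3) by (cases rule: step_cases) (auto simp: mod_Suc less_Suc_eq)
qed

text \<open>A discrete intermediate value argument: moves skip only marks, so a walk meets every
  letter cell it passes. This turns the scattered indices into a complete factor of
  \<open>t\<close>.\<close>

lemma hit_up:
  fixes w :: "nat \<Rightarrow> nat"
  assumes "lo \<le> hi" "\<And>j. lo \<le> j \<Longrightarrow> j < hi \<Longrightarrow> \<bar>int (w j) - int (w (j + 1))\<bar> \<le> int k"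
    and "cell (w lo) \<le> g" "g \<le> cell (w hi)" "g mod 3 \<noteq> 2"
  shows "\<exists>j. lo \<le> j \<and> j \<le> hi \<and> cell (w j) = g"
proof (rule ccontr)
  assume no: "\<not> ?thesis"
  have "cell (w j) < g" if "lo \<le> j" "j \<le> hi" for j
    using that
  proof (induction j rule: dec_induct)
    case base
    then show ?case using no assms(1,3) by (metis le_neq_implies_less order_refl)
  next
    case (step j)
    then have "cell (w j) < g" by simp
    moreover have "cell (w (j + 1)) \<noteq> g" using no step by (metis Suc_eq_plus1 le_SucI)
    ultimately show ?case using step_avoid[of "w j" "w (j + 1)" g] assms(2)[of j] assms(5) step by simp
  qed
  then show False using assms(1,4) by (meson leD order_refl)
qed

lemma hit_down:
  fixes w :: "nat \<Rightarrow> nat"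
  assumes "lo \<le> hi" "\<And>j. lo \<le> j \<Longrightarrow> j < hi \<Longrightarrow> \<bar>int (w j) - int (w (j + 1))\<bar> \<le> int k"
    and "cell (w hi) \<le> g" "g \<le> cell (w lo)" "g mod 3 \<noteq> 2"
  shows "\<exists>j. lo \<le> j \<and> j \<le> hi \<and> cell (w j) = g"
proof -
  have "\<bar>int (w (lo + hi - j)) - int (w (lo + hi - (j + 1)))\<bar> \<le> int k" if "lo \<le> j" "j < hi" for j
  proof -
    have "lo + hi - j = (lo + hi - (j + 1)) + 1" using that by simp
    then show ?thesis using assms(2)[of "lo + hi - (j + 1)"] that by (simp add: abs_minus_commute)
  qed
  then obtain j where "lo \<le> j" "j \<le> hi" "cell (w (lo + hi - j)) = g"
    using hit_up[of lo hi "\<lambda>j. w (lo + hi - j)" g] assms by auto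
  then show ?thesis by (intro exI[of _ "lo + hi - j"]) auto
qed

end

subsection \<open>Folded walks\<close>

text \<open>A bad index sequence for \<open>word\<close>, to be refuted. Index \<open>j\<close> is
  matched with \<open>j + r\<close>, and the walk turns from falling to rising at
  \<open>m\<close>.\<close>

locale folded_walk = blow_up +
  fixes r m :: nat and i :: "nat \<Rightarrow> nat"
  assumes m: "1 < m" "m \<le> 2 * r"
    and rep: "\<And>j. 1 \<le> j \<Longrightarrow> j \<le> r \<Longrightarrow> word (i j) = word (i (j + r))"
    and down: "\<And>j. 1 \<le> j \<Longrightarrow> j < m \<Longrightarrow> i (j + 1) < i j"
    and up: "\<And>j. m \<le> j \<Longrightarrow> j < 2 * r \<Longrightarrow> i j < i (j + 1)"
    and step: "\<And>j. 1 \<le> j \<Longrightarrow> j < 2 * r \<Longrightarrow> \<bar>int (i j) - int (i (j + 1))\<bar> \<le> int k"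
    and turn: "m < 2 * r \<Longrightarrow> i (m + 1) < i m + k"
begin

abbreviation "C j \<equiv> cell (i j)"
abbreviation "B j \<equiv> block (i j)"

lemma step_down: "1 \<le> j \<Longrightarrow> j < m \<Longrightarrow> i j \<le> i (j + 1) + k"
  using step[of j] down[of j] m by simp

lemma step_up: "m \<le> j \<Longrightarrow> j < 2 * r \<Longrightarrow> i (j + 1) \<le> i j + k"
  using step[of j] up[of j] m by simp

lemma down_chain: "j < l \<Longrightarrow> 1 \<le> j \<Longrightarrow> l \<le> m \<Longrightarrow> i l < i j"
proof (induction l rule: less_Suc_induct)
  case (1 l)
  then show ?case using down[of l] by simp
next
  case (2 a b c)
  then show ?case by simp
qed

lemma up_chain: "j < l \<Longrightarrow> m \<le> j \<Longrightarrow> l \<le> 2 * r \<Longrightarrow> i j < i l"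
proof (induction l rule: less_Suc_induct)
  case (1 l)
  then show ?case using up[of l] by simp
next
  case (2 a b c)
  then show ?case by simp
qed

lemma rep_clr: "1 \<le> j \<Longrightarrow> j \<le> r \<Longrightarrow> clr (C j) = clr (C (j + r))"
  using rep[of j] by (simp add: word_eq_iff)

lemma rep_mark: "1 \<le> j \<Longrightarrow> j \<le> r \<Longrightarrow> C j mod 3 = 2 \<longleftrightarrow> C (j + r) mod 3 = 2"
  using rep_clr[of j] clr_eq_3 by metis

lemma rep_tern:
  assumes "1 \<le> j" "j \<le> r" "C j = cell_of z"
  shows "tern z = tern (B (j + r))"
proof -
  have "z mod 2 \<noteq> 2" by presburger
  then have "C (j + r) mod 3 \<noteq> 2" using rep_mark[of j] assms by simp
  then have "C (j + r) = cell_of (B (j + r))" by (simp add: cell_of_blk)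
  then show ?thesis using rep_clr[of j] assms clr_cell_of by metis
qed

lemma opposite:
  assumes "1 \<le> j" "j < r" "j < m" "m \<le> j + r"
  shows "C j = C (j + 1) + 1" "C (j + r + 1) = C (j + r) + 1"
    and "C j mod 3 \<noteq> 2 \<Longrightarrow> C (j + 1) mod 3 \<noteq> 2 \<Longrightarrow> i (j + r + 1) = i (j + r) + k"
  using opposite_steps[of "i (j + 1)" "i j" "i (j + r)" "i (j + r + 1)"] assms
    down[of j] up[of "j + r"] step_down[of j] step_up[of "j + r"] rep[of j] rep[of "j + 1"]
  by (simp_all add: add.commute add.left_commute)

lemma opposite_chain:
  assumes "1 \<le> a" "a \<le> j" "j \<le> b" "b \<le> r" "b \<le> m" "m \<le> a + r"
  shows "C j + (j - a) = C a \<and> C (j + r) = C (a + r) + (j - a)"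
  using assms(2,3)
proof (induction j rule: dec_induct)
  case (step n)
  then have "C n = C (n + 1) + 1" "C (n + r + 1) = C (n + r) + 1"
    using opposite[of n] assms by simp_all
  then show ?case using step by (simp add: Suc_diff_le)
qed simp

text \<open>The letters met while falling from \<open>a\<close> to \<open>b\<close> are met again in
  the same order while rising. If the rise begins near the end of the fall,
  \<open>clr_mirror\<close> applies. This separates the cell of the turn from that of an index next
  to the middle of the walk.\<close>

lemma no_mirror:
  assumes "1 \<le> a" "a < b" "b \<le> r" "b \<le> m" "m \<le> a + r" "C (a + r) \<le> C b + 2" "C b \<le> C (a + r) + 2"
  shows False
proof (rule clr_mirror[of "b - a" "\<lambda>l. C (a + l)" "\<lambda>l. C (a + l + r)"])
  fix l assume l: "l \<le> b - a"
  show "clr (C (a + l)) = clr (C (a + l + r))" using l assms by (intro rep_clr) auto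
  show "C (a + l) + l = C (a + 0)" "C (a + l + r) = C (a + 0 + r) + l"
    using opposite_chain[of a "a + l" b] l assms by auto
qed (use assms in auto)

text \<open>Telescopes \<open>parallel_steps\<close> while both matched moves fall: the gap between
  \<open>B j\<close> and \<open>B (j + r)\<close> is constant. After the turn,
  \<open>shift_up\<close> does the same.\<close>

lemma shift_down: "1 \<le> j \<Longrightarrow> j \<le> r \<Longrightarrow> j + r \<le> m \<Longrightarrow> B j + B (r + 1) = B 1 + B (j + r)"
proof (induction j rule: dec_induct)
  case (step j)
  have "B j + B (j + 1 + r) = B (j + r) + B (j + 1)"
    using parallel_steps[of "i (j + 1)" "i j" "i (j + 1 + r)" "i (j + r)"] step
      down[of j] down[of "j + r"] step_down[of j] step_down[of "j + r"] rep[of j] rep[of "j + 1"]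
    by simp
  then show ?case using step by simp
qed (simp add: add.commute)

lemma shift_up: "m \<le> j \<Longrightarrow> j \<le> r \<Longrightarrow> B (j + r) + B m = B j + B (m + r)"
proof (induction j rule: dec_induct)
  case (step j)
  have "B (j + 1) + B (j + r) = B (j + 1 + r) + B j"
    using parallel_steps[of "i j" "i (j + 1)" "i (j + r)" "i (j + 1 + r)"] step m
      up[of j] up[of "j + r"] step_up[of j] step_up[of "j + r"] rep[of j] rep[of "j + 1"]
    by simp
  then show ?case using step by simp
qed simp

text \<open>The fall from \<open>i 1\<close> to \<open>i (r + 1)\<close> meets \<open>q\<close>
  consecutive letters of \<open>t\<close>, each equal to the letter \<open>q\<close> places earlier.
  Restricting \<open>shift\<close> to letter cells lets a caller leave a mark uncontrolled.\<close>

lemma no_square_down: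
  assumes "r < m" "q \<ge> 1" "B 1 = B (r + 1) + q"
    and shift: "\<And>j. 1 \<le> j \<Longrightarrow> j \<le> r \<Longrightarrow> C j mod 3 \<noteq> 2 \<Longrightarrow> B j = B (j + r) + q"
  shows False
proof -
  \<comment> \<open>The window must consist of the letter cells above \<open>C (r + 1)\<close> and
    up to \<open>C 1\<close>. The number \<open>blk\<close> of a mark belongs to the letter after
    it, so the window starts one earlier when both ends are marks.\<close>
  define x where "x = (if C 1 mod 3 = 2 then B (r + 1) else B (r + 1) + 1)"
  have r: "r \<ge> 1" using m by simp
  show False
  proof (rule tern_square_free_left[OF assms(2), of x])
    fix z assume z: "x \<le> z" "z < x + q"
    have nm: "cell_of z mod 3 \<noteq> 2" unfolding cell_of_mod by presburger
    have "C (r + 1) < cell_of z \<and> cell_of z \<le> C 1"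
    proof (cases "C 1 mod 3 = 2")
      case True
      then have "cell_of (B 1) = C 1 + 1" "cell_of (B (r + 1)) = C (r + 1) + 1"
        using rep_mark[of 1] r by (simp_all add: cell_of_blk_mark)
      moreover have "B (r + 1) \<le> z" "z < B 1" using True z assms(3) unfolding x_def by auto
      ultimately show ?thesis using cell_of_le[of "B (r + 1)" z] cell_of_less[of z "B 1"] by linarith
    next
      case False
      then have "cell_of (B 1) = C 1" "cell_of (B (r + 1)) = C (r + 1)"
        using rep_mark[of 1] r by (simp_all add: cell_of_blk)
      moreover have "B (r + 1) < z" "z \<le> B 1" using False z assms(3) unfolding x_def by auto
      ultimately show ?thesis using cell_of_less[of "B (r + 1)" z] cell_of_le[of z "B 1"] by linarith
    qed
    then have "\<exists>j. 1 \<le> j \<and> j \<le> r + 1 \<and> C j = cell_of z" "C (r + 1) \<noteq> cell_of z"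
      using hit_down[of 1 "r + 1" i "cell_of z"] step assms(1) m nm by auto
    then obtain j where j: "1 \<le> j" "j \<le> r" "C j = cell_of z" by (metis le_Suc_eq Suc_eq_plus1)
    then have "z = B (j + r) + q" using shift[of j] nm by simp
    then show "\<exists>y. z = y + q \<and> tern z = tern y" using rep_tern[OF j] by blast
  qed
qed

section \<open>Excluding every position of the turn\<close>

lemma all_down_impossible: "m \<noteq> 2 * r"
proof
  assume eq: "m = 2 * r"
  have r: "r \<ge> 1" using m by simp
  have less: "B (r + 1) < B 1"
    using block_less[of "i (r + 1)" "i 1"] down_chain[of 1 "r + 1"] rep[of 1] r eq by simp
  show False
  proof (rule no_square_down[of "B 1 - B (r + 1)"])
    fix j assume "1 \<le> j" "j \<le> r"
    then show "B j = B (j + r) + (B 1 - B (r + 1))" using shift_down[of j] less eq by simp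
  qed (use less eq r in auto)
qed

text \<open>With \<open>a = m - r\<close>, matched moves are parallel before \<open>a\<close> and
  opposite from \<open>a\<close> to \<open>r\<close>. The cells around \<open>a\<close> and
  \<open>m\<close> are compared modulo 3.\<close>

lemma late_turn_impossible:
  assumes "r < m" "m < 2 * r"
  shows False
proof -
  define a where "a = m - r"
  have a: "m = a + r" "1 \<le> a" "a < r" using assms unfolding a_def by auto
  have far: "C (r + 1) \<noteq> C m"
    using no_mirror[of a r] step_cell[of "i r" "i (r + 1)"] step[of r] a by auto
  then have a2: "a \<ge> 2" using a by (cases "a = 1") (auto simp: add.commute)
  have less: "B (j + r) < B j" if "1 \<le> j" "j \<le> a" for j
    using block_less[of "i (j + r)" "i j"] down_chain[of j "j + r"] rep[of j] that a by simp
  define q where "q = B 1 - B (r + 1)"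
  have q: "q \<ge> 1" "B 1 = B (r + 1) + q" using less[of 1] a unfolding q_def by auto
  have shift: "B j = B (j + r) + q" if "1 \<le> j" "j \<le> a" for j
    using shift_down[of j] q(2) that a by simp
  have opp: "C a = C (a + 1) + 1" "C (m + 1) = C m + 1" using opposite[of a] a by simp_all
  show False
  proof (cases "C a mod 3 = 2")
    case True
    then have mk: "C m mod 3 = 2" using rep_mark[of a] a by simp
    have "i a < i (a - 1)" "i (a - 1) \<le> i a + k" using down[of "a - 1"] step_down[of "a - 1"] a a2 by auto
    then have 1: "C (a - 1) = C a + 1" using True by (cases rule: step_cases) auto
    have "i m < i (m - 1)" "i (m - 1) \<le> i m + k" using down[of "m - 1"] step_down[of "m - 1"] a a2 by auto
    then have 2: "C (m - 1) = C m + 1" using mk by (cases rule: step_cases) auto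
    \<comment> \<open>Here \<open>C (m - 1) = C (m + 1)\<close>, so the cells
      \<open>C (a + 1)\<close> and \<open>C (a + 1) + 2\<close> would carry the same letter.\<close>
    have "clr (C (a - 1)) = clr (C (m - 1))" using rep_clr[of "a - 1"] a a2 by simp
    moreover have "clr (C (a + 1)) = clr (C (m + 1))" using rep_clr[of "a + 1"] a by (simp add: add.commute add.left_commute)
    ultimately show False using 1 2 opp clr_Suc_Suc[of "C (a + 1)"] by simp
  next
    case False
    \<comment> \<open>If both cells were blocks, the move after the turn would have length exactly
      \<open>k\<close>, against \<open>turn\<close>.\<close>
    have mk: "C (a + 1) mod 3 = 2"
    proof (rule ccontr)
      assume "\<not> ?thesis"
      then have "i (a + r + 1) = i (a + r) + k" using False opposite(3)[of a] a by simp
      then show False using turn a by simp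
    qed
    have mk': "C (m + 1) mod 3 = 2" using rep_mark[of "a + 1"] mk a by (simp add: add.commute add.left_commute)
    obtain e where e: "C a = 3 * e" "e \<ge> 1"
      using mk opp(1) by (cases "C (a + 1)" rule: mod3_cases) (auto simp: mod_Suc intro: that[of "Suc _"])
    obtain f where f: "C m = 3 * f + 1"
      using mk' opp(2) by (cases "C m" rule: mod3_cases) (auto simp: mod_Suc)
    have B: "B a = 2 * e" "B m = 2 * f + 1" using e f by simp_all
    have ef: "2 * e = 2 * f + 1 + q" using shift[of a] B a by simp
    show False
    proof (cases "a + 1 = r")
      case True
      show False
      \<comment> \<open>The only index beyond the reach of \<open>shift\<close> is
        \<open>r = a + 1\<close>, and it sits on a mark.\<close>
      proof (rule no_square_down[OF assms(1) q])
        fix j assume j: "1 \<le> j" "j \<le> r" "C j mod 3 \<noteq> 2"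
        then have "j \<noteq> r" using mk True by auto
        then show "B j = B (j + r) + q" using shift[of j] j True by simp
      qed
    next
      case False
      then have ar: "a + 2 \<le> r" using a by simp
      have "C (a + 2) + 2 = 3 * e" "C (m + 2) = 3 * f + 3"
        using opposite_chain[of a "a + 2" "a + 2"] e f a ar by (simp_all add: add.commute add.left_commute)
      moreover have "cell_of (2 * e - 1) + 2 = 3 * e" using e cell_of_simps(2)[of "e - 1"]
        by (cases e) auto
      moreover have "cell_of (2 * (f + 1)) = 3 * (f + 1)" by (rule cell_of_simps)
      ultimately have "C (a + 2) = cell_of (2 * e - 1)" "C (m + 2) = cell_of (2 * (f + 1))"
        by simp_all
      then have "C (a + 2) = cell_of (2 * e - 1)" "B (m + 2) = 2 * (f + 1)"
        by (simp_all only: blk_cell_of)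
      then have 1: "tern (2 * e - 1) = tern (2 * (f + 1))"
        using rep_tern[of "a + 2" "2 * e - 1"] a ar by (simp add: add.commute add.left_commute)
      show False
      proof (cases "\<exists>j. 1 \<le> j \<and> j \<le> a \<and> C j = 3 * e + 1")
        case True
        then obtain j where j: "1 \<le> j" "j \<le> a" "C j = 3 * e + 1" by blast
        \<comment> \<open>Positions \<open>2 * e - 1\<close> and \<open>2 * e + 1\<close> of
          \<open>t\<close> both match the even position \<open>2 * (f + 1)\<close>, so two
          successive odd positions are nonzero.\<close>
        then have "B (j + r) = 2 * (f + 1)" using shift[of j] ef by simp
        then have "tern (2 * e + 1) = tern (2 * (f + 1))" using rep_tern[of j "2 * e + 1"] j a by simp
        moreover have "tern (2 * (f + 1)) \<noteq> 0" by (rule tern_even) simp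
        ultimately show False using tern_odd[of "2 * e - 1"] 1 e by simp
      next
        case False
        \<comment> \<open>A fall that misses the letter cell \<open>3 * e + 1\<close> stays in the
          cell of \<open>a\<close>; its shifted copy then stays in the cell of \<open>m\<close>,
          against \<open>far\<close>.\<close>
        then have "\<not> 3 * e + 1 \<le> C 1"
          using hit_down[of 1 a i "3 * e + 1"] step a e(1) by (auto simp: mod_Suc)
        moreover have "C a \<le> C 1" using down_chain[of 1 a] a a2 by (intro cell_mono) simp
        ultimately have eq: "C 1 = C a" using e by simp
        then have "B (r + 1) = B m" using shift[of 1] shift[of a] a by simp
        moreover have "C (r + 1) mod 3 \<noteq> 2" "C m mod 3 \<noteq> 2"
          using rep_mark[of 1] rep_mark[of a] eq e a by (simp_all add: mod_Suc)
        ultimately show False using far cell_of_blk by metis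
      qed
    qed
  qed
qed

text \<open>Now matched moves are opposite before \<open>m\<close> and parallel, both rising, from
  \<open>m\<close> to \<open>r\<close>. The cases are the residues modulo 3 of the cells at
  \<open>m\<close> and \<open>m - 1\<close>.\<close>

lemma early_turn_impossible:
  assumes "m \<le> r"
  shows False
proof -
  have far: "C r \<noteq> C m"
    using no_mirror[of 1 m] step_cell[of "i r" "i (r + 1)"] step[of r] m assms by (auto simp: add.commute)
  then have mr: "m < r" using assms by (cases "m = r") auto
  have less: "B j < B (j + r)" if "m \<le> j" "j \<le> r" for j
    using block_less[of "i j" "i (j + r)"] up_chain[of j "j + r"] rep[of j] that m mr by simp
  define q where "q = B (m + r) - B m"
  have q: "q \<ge> 1" "B (m + r) = B m + q" using less[of m] mr unfolding q_def by auto
  have shift: "B (j + r) = B j + q" if "m \<le> j" "j \<le> r" for j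
    using shift_up[of j] q(2) that by simp
  have opp: "C (m - 1) = C m + 1" "C (m + r) = C (m + r - 1) + 1"
    using opposite[of "m - 1"] m mr by (simp_all add: add.commute)
  have rc: "clr (C (m - 1)) = clr (C (m + r - 1))"
    using rep_clr[of "m - 1"] m mr by simp
  have le: "C m \<le> C r" using up_chain[of m r] mr by (intro cell_mono) simp
  have hit: "\<exists>j. m \<le> j \<and> j \<le> r \<and> C j = g" if "C m \<le> g" "g \<le> C r" "g mod 3 \<noteq> 2" for g
    using hit_up[of m r i g] step m mr that by auto
  show False
  proof (cases "C m mod 3 = 2")
    case True
    then have mk: "C (m + r) mod 3 = 2" using rep_mark[of m] m mr by simp
    have "i m < i (m + 1)" "i (m + 1) \<le> i m + k" using up[of m] step_up[of m] mr by auto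
    then have 1: "C (m + 1) = C m + 1" using True by (cases rule: step_cases) auto
    have "i (m + r) < i (m + r + 1)" "i (m + r + 1) \<le> i (m + r) + k"
      using up[of "m + r"] step_up[of "m + r"] mr by auto
    then have 2: "C (m + r + 1) = C (m + r) + 1" using mk by (cases rule: step_cases) auto
    \<comment> \<open>Here \<open>C (m + 1) = C (m - 1)\<close>, so the cells
      \<open>C (m + r - 1)\<close> and \<open>C (m + r - 1) + 2\<close> would carry the same
      letter.\<close>
    have "clr (C (m + 1)) = clr (C (m + r + 1))" using rep_clr[of "m + 1"] mr by simp
    then show False using 1 2 opp rc clr_Suc_Suc[of "C (m + r - 1)"] by simp
  next
    case nonmark: False
    then have nonmark': "C (m + r) mod 3 \<noteq> 2" using rep_mark[of m] m mr by simp
    have rm: "C (m - 1) mod 3 = 2 \<longleftrightarrow> C (m + r - 1) mod 3 = 2"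
      using rep_mark[of "m - 1"] m mr by simp
    show False
    proof (cases "C (m - 1) mod 3 = 2")
      case True
      obtain e where e: "C m = 3 * e + 1"
        using True opp(1) by (cases "C m" rule: mod3_cases) (auto simp: mod_Suc)
      obtain f where f: "C (m + r) = 3 * f + 3"
        using True rm opp(2) by (cases "C (m + r - 1)" rule: mod3_cases) (auto simp: mod_Suc)
      have f': "C (m + r) = cell_of (2 * (f + 1))" using f cell_of_simps(1)[of "f + 1"] by simp
      have B: "B m = 2 * e + 1" "B (m + r) = 2 * (f + 1)"
        using e by (simp, simp only: f' blk_cell_of)
      have ef: "2 * (f + 1) = 2 * e + 1 + q" using q B by simp
      show False
      proof (cases "m = 2")
        case True
        have mk: "C (r + 1) mod 3 = 2" "C (r + 1) = 3 * f + 2"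
          using \<open>C (m - 1) mod 3 = 2\<close> rm opp f True by (simp_all add: add.commute)
        show False
        \<comment> \<open>The rise from \<open>m\<close> to \<open>r + 1\<close> ends on the mark
          just below the letter \<open>B m + q\<close>, so it meets a whole period before that
          mark.\<close>
        proof (rule tern_square_free[OF q(1), of "B m"])
          fix z assume z: "B m \<le> z" "z < B m + q"
          have nm: "cell_of z mod 3 \<noteq> 2" unfolding cell_of_mod by presburger
          have "cell_of (B m) \<le> cell_of z" "cell_of z < cell_of (2 * (f + 1))"
            using z q(2) B(2) cell_of_le[of "B m" z] cell_of_less[of z "2 * (f + 1)"] by simp_all
          then have "C m \<le> cell_of z" "cell_of z \<le> C (r + 1)"
            using nonmark mk(2) f f' by (simp_all add: cell_of_blk)
          then have "\<exists>j. m \<le> j \<and> j \<le> r + 1 \<and> C j = cell_of z"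
            using hit_up[of m "r + 1" i "cell_of z"] step m mr nm by auto
          then obtain j where j: "m \<le> j" "j \<le> r" "C j = cell_of z"
            using mk(1) nm by (metis le_Suc_eq Suc_eq_plus1)
          then show "tern z = tern (z + q)" using rep_tern[of j z] shift[of j] m by simp
        qed
      next
        case False
        then have m3: "m \<ge> 3" using m by simp
        have a: "1 \<le> m - 2" "m \<le> m - 2 + r" "m - 2 + r = m + r - 2" using m3 mr by linarith+
        then have "C (m - 2) = 3 * e + 3" "C (m + r - 2) = 3 * f + 1"
          using opposite_chain[OF a(1) _ order_refl _ order_refl a(2)] a(3) m3 mr e f by simp_all
        then have "C (m - 2) = cell_of (2 * (e + 1))" "B (m + r - 2) = 2 * f + 1"
          using cell_of_simps(1)[of "e + 1"] by simp_all
        then have 1: "tern (2 * (e + 1)) = tern (2 * f + 1)"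
          using rep_tern[of "m - 2" "2 * (e + 1)"] m3 mr by simp
        \<comment> \<open>Otherwise the letter \<open>2 * (e + 1)\<close>, nonzero by parity, would
          match both \<open>2 * f + 1\<close> and \<open>2 * f + 3\<close>, against
          \<open>tern_odd\<close>.\<close>
        have not: "\<not> 3 * e + 3 \<le> C r"
        proof
          assume "3 * e + 3 \<le> C r"
          then obtain j where j: "m \<le> j" "j \<le> r" "C j = 3 * e + 3"
            using hit[of "3 * e + 3"] e by auto
          then have c: "C j = cell_of (2 * (e + 1))" using cell_of_simps(1)[of "e + 1"] by simp
          then have "B j = 2 * (e + 1)" by (simp only: blk_cell_of)
          then have "B (j + r) = 2 * f + 3" using shift[of j] j ef by simp
          then have "tern (2 * (e + 1)) = tern (2 * f + 3)" using rep_tern[OF _ j(2) c] j m by simp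
          moreover have "tern (2 * (e + 1)) \<noteq> 0" by (rule tern_even) simp
          ultimately show False using tern_odd[of "2 * f + 1"] 1 by (simp add: numeral_3_eq_3)
        qed
        \<comment> \<open>The rise ends on a mark; the shift by the odd \<open>q\<close> gives the
          matching mark an odd block number, which no mark has.\<close>
        then have "C r = 3 * e + 2" using le e far by simp
        moreover from this have "B r = 2 * e + 2" by simp
        ultimately have "B (r + r) = 2 * f + 3" "C (r + r) mod 3 = 2"
          using shift[of r] rep_mark[of r] mr m ef by (simp_all add: mod_Suc)
        then show False using even_blk_mark[of "C (r + r)"] by simp
      qed
    next
      case False
      obtain e where e: "C m = 3 * e"
        using False nonmark opp(1) by (cases "C m" rule: mod3_cases) (auto simp: mod_Suc)
      obtain f where f: "C (m + r) = 3 * f + 1"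
        using False rm nonmark' opp(2) by (cases "C (m + r - 1)" rule: mod3_cases) (auto simp: mod_Suc)
      have ef: "2 * f + 1 = 2 * e + q" using q e f by simp
      have "C (m + r - 1) = 3 * f" using opp f by simp
      then have "B (m + r - 1) = 2 * f" by simp
      then have 1: "tern (2 * e + 1) = tern (2 * f)"
        using rep_tern[of "m - 1" "2 * e + 1"] opp e m mr by simp
      have 2: "tern (2 * e) = tern (2 * f + 1)" using rep_tern[of m "2 * e"] e f m mr by simp
      have "3 * e + 1 \<le> C r" using le far e by simp
      then obtain j where j: "m \<le> j" "j \<le> r" "C j = 3 * e + 1"
        using hit[of "3 * e + 1"] e by (auto simp: mod_Suc)
      \<comment> \<open>The letter \<open>2 * e + 1\<close> matches \<open>2 * f\<close> before the
        turn and \<open>2 * f + 2\<close> after it, so \<open>tern_even_return\<close> yields zeros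
        at \<open>2 * f - 1\<close> and \<open>2 * f + 3\<close>. Each remaining case matches the
        nonzero letter \<open>2 * (e + 1)\<close> with one of them.\<close>
      then have "B (j + r) = 2 * f + 2" using shift[of j] ef by simp
      then have "tern (2 * e + 1) = tern (2 * f + 2)" using rep_tern[of j "2 * e + 1"] j m by simp
      then have ret: "tern (2 * f) = tern (2 * f + 2)" using 1 by simp
      have "f \<noteq> e" using 2 tern_adjacent[of "2 * e"] by auto
      moreover have "f \<noteq> e + 1" using 1 tern_adjacent[of "2 * e + 1"] by auto
      ultimately have fe: "f \<ge> e + 2" using ef q(1) by linarith
      have nz: "tern (2 * (e + 1)) \<noteq> 0" by (rule tern_even) simp
      have c3: "cell_of (2 * (e + 1)) = 3 * e + 3" using cell_of_simps(1)[of "e + 1"] by simp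
      show False
      proof (cases "m \<ge> 4")
        case True
        have a: "1 \<le> m - 3" "m \<le> m - 3 + r" "m - 3 + r = m + r - 3" using True mr by linarith+
        then have "C (m - 3) = 3 * e + 3" "C (m + r - 3) + 3 = 3 * f + 1"
          using opposite_chain[OF a(1) _ order_refl _ order_refl a(2)] a(3) True mr e f by simp_all
        moreover have "cell_of (2 * (f - 1) + 1) = 3 * (f - 1) + 1" by (rule cell_of_simps)
        ultimately have "C (m - 3) = cell_of (2 * (e + 1))" "C (m + r - 3) = cell_of (2 * (f - 1) + 1)"
          using c3 fe by simp_all
        then have "C (m - 3) = cell_of (2 * (e + 1))" "B (m + r - 3) = 2 * (f - 1) + 1"
          by (simp_all only: blk_cell_of)
        then have "tern (2 * (e + 1)) = tern (2 * (f - 1) + 1)"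
          using rep_tern[of "m - 3" "2 * (e + 1)"] True mr by simp
        moreover have "2 * (f - 1) + 1 = 2 * f - 1" using fe by simp
        ultimately show False using tern_even_return(2)[OF ret] nz fe by simp
      next
        case False
        \<comment> \<open>With at most two opposite moves, \<open>C (r + 1)\<close> lies at most two
          cells below \<open>C (m + r)\<close>; since \<open>f >= e + 2\<close>, the rise up to
          \<open>r\<close> already reaches the cell \<open>3 * e + 3\<close>.\<close>
        have "C (m + r) = C (r + 1) + (m - 1)"
          using opposite_chain[of 1 m m] m mr by (auto simp: add.commute)
        moreover have "C (r + 1) \<le> C r + 2" using step_cell[of "i r" "i (r + 1)"] step[of r] m mr by simp
        ultimately have "3 * e + 3 \<le> C r" using f fe False by linarith
        then obtain j where j: "m \<le> j" "j \<le> r" "C j = 3 * e + 3"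
          using hit[of "3 * e + 3"] e by auto
        then have c: "C j = cell_of (2 * (e + 1))" using c3 by simp
        then have "B j = 2 * (e + 1)" by (simp only: blk_cell_of)
        then have "B (j + r) = 2 * f + 3" using shift[of j] j ef by simp
        then have "tern (2 * (e + 1)) = tern (2 * f + 3)" using rep_tern[OF _ j(2) c] j m by simp
        then show False using tern_even_return(1)[OF ret] nz by simp
      qed
    qed
  qed
qed

end

theorem theorem8:
  fixes k N :: nat
  assumes "k \<ge> 1"
  shows "\<exists>(A :: nat set) (n :: nat) (s :: nat \<Rightarrow> nat).
    card A = 3 * k + 1 \<and> n \<ge> N \<and> s ` {1..n} \<subseteq> A \<and> special k {1..n} s"
proof -
  interpret blow_up k by unfold_locales (rule assms)
  have "special k {1..N} word"
    unfolding special_def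
  proof (intro notI, elim exE)
    fix r i assume "bad_indices k {1..N} word r i"
    then obtain m where "folded_walk k r m i"
      unfolding bad_indices_def folded_walk_def folded_walk_axioms_def using blow_up_axioms by blast
    then interpret folded_walk k r m i .
    consider "m \<le> r" | "r < m" "m < 2 * r" | "m = 2 * r" using m by linarith
    then show False
      using early_turn_impossible late_turn_impossible all_down_impossible by cases auto
  qed
  moreover have "word ` {1..N} \<subseteq> {..<3 * k + 1}" using word_less by auto
  ultimately show ?thesis
    by (intro exI[of _ "{..<3 * k + 1}"] exI[of _ N] exI[of _ word]) simp
qed

end
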